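(* Let $k\in[2.5,3)$ be rational and $\varepsilon$ a positive real with $\varepsilon<\frac{1}{k+\varepsilon}$. Then there exist a graph $G$ with fractional chromatic number $k$, a set $W\subseteq V(G)$ of vertices at pairwise distance at least six, and a fractional $(k+\varepsilon)$-precoloring of $W$ that cannot be extended to a fractional $(k+\varepsilon)$-coloring of $G$.
   Context: A fractional $m$-coloring of a graph (real $m>0$) assigns to each vertex a measurable subset of $[0,m)$ of Lebesgue measure one so that adjacent vertices receive disjoint sets; the fractional chromatic number is the infimum (for finite graphs the minimum) of $m$ for which a fractional $m$-coloring exists. A fractional $m$-precoloring of a vertex set $W$ assigns measurable subsets of $[0,m)$ of measure one to the vertices of $W$; it extends if some fractional $m$-coloring of the whole graph agrees with it on $W$. Graphs are finite. *)

theory Defs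
  imports "HOL-Analysis.Analysis"
begin

definition simple_graph :: "'a set \<Rightarrow> ('a \<Rightarrow> 'a \<Rightarrow> bool) \<Rightarrow> bool" where
  "simple_graph V E \<longleftrightarrow> finite V \<and> (\<forall>u v. E u v \<longrightarrow> u \<in> V \<and> v \<in> V)
     \<and> (\<forall>u v. E u v \<longrightarrow> E v u) \<and> (\<forall>u. \<not> E u u)"

definition unit_subset :: "real \<Rightarrow> real set \<Rightarrow> bool" where
  "unit_subset m S \<longleftrightarrow> S \<in> sets lebesgue \<and> S \<subseteq> {0..<m} \<and> emeasure lebesgue S = 1"

definition frac_coloring :: "'a set \<Rightarrow> ('a \<Rightarrow> 'a \<Rightarrow> bool) \<Rightarrow> real \<Rightarrow> ('a \<Rightarrow> real set) \<Rightarrow> bool" where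
  "frac_coloring V E m f \<longleftrightarrow> (\<forall>v\<in>V. unit_subset m (f v))
     \<and> (\<forall>u\<in>V. \<forall>v\<in>V. E u v \<longrightarrow> f u \<inter> f v = {})"

definition frac_chromatic_number :: "'a set \<Rightarrow> ('a \<Rightarrow> 'a \<Rightarrow> bool) \<Rightarrow> real" where
  "frac_chromatic_number V E = Inf {m. m > 0 \<and> (\<exists>f. frac_coloring V E m f)}"

definition frac_precoloring :: "'a set \<Rightarrow> real \<Rightarrow> ('a \<Rightarrow> real set) \<Rightarrow> bool" where
  "frac_precoloring W m p \<longleftrightarrow> (\<forall>w\<in>W. unit_subset m (p w))"

definition precoloring_extends ::
  "'a set \<Rightarrow> ('a \<Rightarrow> 'a \<Rightarrow> bool) \<Rightarrow> 'a set \<Rightarrow> real \<Rightarrow> ('a \<Rightarrow> real set) \<Rightarrow> bool" where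
  "precoloring_extends V E W m p \<longleftrightarrow> (\<exists>f. frac_coloring V E m f \<and> (\<forall>w\<in>W. f w = p w))"

inductive walk :: "'a set \<Rightarrow> ('a \<Rightarrow> 'a \<Rightarrow> bool) \<Rightarrow> nat \<Rightarrow> 'a \<Rightarrow> 'a \<Rightarrow> bool"
  for V E where
  walk_refl: "u \<in> V \<Longrightarrow> walk V E 0 u u"
| walk_step: "walk V E n u w \<Longrightarrow> E w v \<Longrightarrow> walk V E (Suc n) u v"

definition pairwise_dist_ge :: "'a set \<Rightarrow> ('a \<Rightarrow> 'a \<Rightarrow> bool) \<Rightarrow> 'a set \<Rightarrow> nat \<Rightarrow> bool" where
  "pairwise_dist_ge V E W d \<longleftrightarrow>
     (\<forall>u\<in>W. \<forall>v\<in>W. u \<noteq> v \<longrightarrow> (\<forall>n<d. \<not> walk V E n u v))"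

end

theory Submission
  imports Defs
begin

text \<open>
  Write $k = (n + 2b)/(2b)$ with $3b \<le> n \<le> 4b$; the bound $3b \<le> n$ is $k \<ge> 5/2$.  A gadget is a
  weighted graph with vertices \<open>U\<close>, \<open>X t\<close>, \<open>P c s\<close>, modelled on the five-cycle (the case $n = 3b$), in
  which every independent set has weight at most $1/k$ of the total and the neighbourhood \<open>X\<close> of \<open>U\<close>
  attains this bound.  Add a twin \<open>W\<close> of \<open>U\<close>, and a copy \<open>V t\<close> of every \<open>X t\<close> that is joined to the
  neighbours of \<open>X t\<close> other than \<open>W\<close>, so that \<open>W\<close> is at distance three from each \<open>V t\<close>.  A colour used
  on \<open>W\<close> is missing on all \<open>X t\<close>, so its occurrences on the \<open>V t\<close> can be charged in place of those on
  the \<open>X t\<close>.  Integrating over the colours, in every fractional $m$-colouring \<open>W\<close> shares on average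
  over $t$ at most $m - k$ with \<open>V t\<close>.  Many gadgets share the vertices \<open>V t\<close>, and their vertices \<open>W\<close>
  are precoloured by equidistributed unit arcs of the circle of length $m$; these meet every set of
  measure one in about $1/m$ on average, which exceeds $m - k$.
\<close>

text \<open>The first argument is the number of the gadget; the vertices \<open>V t\<close> are common to all gadgets.\<close>

datatype vtx = W nat | X nat nat | U nat | P nat bool nat | V nat

instance vtx :: countable
  by countable_datatype

section \<open>Sumsets of residues with intervals, and weights of independent sets\<close>

definition sumset_mod :: "nat \<Rightarrow> nat set \<Rightarrow> nat set \<Rightarrow> nat set" where
  "sumset_mod n J L = (\<lambda>(s, l). (s + l) mod n) ` (J \<times> L)"

lemma inj_on_add_mod: "inj_on (\<lambda>j. (s + j) mod n) {..<n::nat}"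
proof (rule inj_onI)
  fix i j assume "i \<in> {..<n}" "j \<in> {..<n}" and eq: "(s + i) mod n = (s + j) mod n"
  then have "i < n" "j < n" by auto
  have "\<lbrakk>i < n; j < n; (s + i) mod n = (s + j) mod n; i \<le> j\<rbrakk> \<Longrightarrow> i = j" for i j
  proof -
    assume a: "i < n" "j < n" "(s + i) mod n = (s + j) mod n" "i \<le> j"
    then have "n dvd (s + j) - (s + i)"
      by (metis mod_eq_dvd_iff_nat nat_add_left_cancel_le)
    then show "i = j" using a by (auto dest: dvd_imp_le)
  qed
  then show "i = j" using \<open>i < n\<close> \<open>j < n\<close> eq by (metis linear)
qed

text \<open>Settles the case in which a sumset stops growing: a nonempty set of residues closed
  under successor is reached all the way round.\<close>

lemma mod_succ_closed_full:
  fixes n :: nat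
  assumes "S \<subseteq> {..<n}" "s \<in> S" and closed: "\<And>x. x \<in> S \<Longrightarrow> Suc x mod n \<in> S"
  shows "S = {..<n}"
proof -
  have step: "(s + i) mod n \<in> S" for i
  proof (induction i)
    case 0 then show ?case using assms by auto
  next
    case (Suc i) then show ?case using closed[OF Suc] by (simp add: mod_Suc_eq)
  qed
  have "y \<in> S" if "y < n" for y
  proof -
    have "s < n" using assms by auto
    then have "(s + (n - s + y)) mod n = y" using that by simp
    then show ?thesis using step by metis
  qed
  then show ?thesis using assms(1) by auto
qed

lemma sumset_mod_subset: "0 < n \<Longrightarrow> sumset_mod n J L \<subseteq> {..<n}"
  by (auto simp: sumset_mod_def)

text \<open>Lengthening the interval by one adds the successors of the present sums. Either a new
  residue appears, or the sumset is closed under successor and hence is everything; the minimum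
  records the second outcome.\<close>

lemma card_sumset_mod_interval:
  assumes "J \<subseteq> {..<n}" "J \<noteq> {}"
  shows "card (sumset_mod n J {p..p + d}) \<ge> min n (card J + d)"
proof (induction d)
  case 0
  have "inj_on (\<lambda>s. (s + p) mod n) J"
    using inj_on_subset[OF inj_on_add_mod[of p n] assms(1)] by (simp add: add.commute)
  moreover have "sumset_mod n J {p..p + 0} = (\<lambda>s. (s + p) mod n) ` J"
    by (auto simp: sumset_mod_def)
  ultimately show ?case by (simp add: card_image)
next
  case (Suc d)
  let ?S = "sumset_mod n J {p..p + d}" and ?S' = "sumset_mod n J {p..p + Suc d}"
  have n: "0 < n" using assms by auto
  have fin: "finite ?S'" using finite_subset[OF sumset_mod_subset[OF n]] by blast
  have sub: "?S \<subseteq> ?S'" by (force simp: sumset_mod_def)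
  have succ: "Suc x mod n \<in> ?S'" if x: "x \<in> ?S" for x
  proof -
    obtain s l where "s \<in> J" "p \<le> l" "l \<le> p + d" "x = (s + l) mod n"
      using x by (auto simp: sumset_mod_def)
    then have "Suc x mod n = (\<lambda>(s, l). (s + l) mod n) (s, Suc l)" "(s, Suc l) \<in> J \<times> {p..p + Suc d}"
      by (auto simp: mod_Suc_eq)
    then show ?thesis unfolding sumset_mod_def by (metis image_eqI)
  qed
  show ?case
  proof (cases "?S' = ?S")
    case True
    obtain s where "s \<in> J" using assms by auto
    then have "(s + p) mod n \<in> ?S" by (force simp: sumset_mod_def)
    then have "?S = {..<n}"
      using mod_succ_closed_full[OF sumset_mod_subset[OF n]] succ True by metis
    then show ?thesis using True by simp
  next
    case False
    then have "card ?S < card ?S'" using sub fin by (metis psubsetI psubset_card_mono)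
    then show ?thesis using Suc by simp
  qed
qed

lemma card_add_le_of_disjoint_sumset_mod:
  assumes "J \<subseteq> {..<n}" "K \<subseteq> {..<n}" "J \<noteq> {}" "K \<noteq> {}"
    and "p \<le> q" and disj: "sumset_mod n J {p..q} \<inter> K = {}"
  shows "card J + (q - p) + card K \<le> n"
proof -
  have n: "0 < n" using assms by auto
  have fin: "finite (sumset_mod n J {p..q})" "finite K"
    using finite_subset[OF sumset_mod_subset[OF n]] assms(2) finite_subset by blast+
  have "card (sumset_mod n J {p..q}) + card K = card (sumset_mod n J {p..q} \<union> K)"
    using card_Un_disjoint[OF fin disj] by simp
  also have "\<dots> \<le> card {..<n}"
    using sumset_mod_subset[OF n] assms(2) by (intro card_mono) auto
  finally have "card (sumset_mod n J {p..q}) + card K \<le> n" by simp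
  moreover have "card (sumset_mod n J {p..q}) \<ge> min n (card J + (q - p))"
    using card_sumset_mod_interval[OF assms(1,3), where p = p and d = "q - p"]
    unfolding le_add_diff_inverse[OF assms(5)] .
  \<comment> \<open>A nonempty \<open>K\<close> leaves the sumset fewer than n elements, so the
    minimum is not n.\<close>
  moreover have "card K > 0" using fin(2) assms(4) by (simp add: card_gt_0_iff)
  ultimately show ?thesis by linarith
qed

text \<open>
  The weights are $2b$ on every \<open>X t\<close>, $n - 2b$ on every \<open>P c s\<close> and $(4b - n)n$ on \<open>U\<close>; the sets \<open>J\<close>,
  \<open>K\<close>, \<open>T\<close> are the indices of the vertices \<open>P True\<close>, \<open>P False\<close> and \<open>X\<close> (or \<open>V\<close>) in an independent set.
\<close>

lemma independent_weight_le:
  fixes n b :: nat and J K T :: "nat set"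
  assumes n: "3 * b \<le> n" "n \<le> 4 * b"
    and sub: "J \<subseteq> {..<n}" "K \<subseteq> {..<n}" "T \<subseteq> {..<n}"
    and JK: "sumset_mod n J {b..n - b} \<inter> K = {}"
    and JT: "sumset_mod n (J \<union> K) {b..n - 2 * b} \<inter> T = {}"
    and u: "u \<Longrightarrow> T = {}"
  shows "2 * real b * card T + (real n - 2 * real b) * (real (card J) + real (card K))
           + (if u then (4 * real b - real n) * real n else 0) \<le> 2 * real n * real b"
proof -
  have fin: "finite J" "finite K" "finite T" using sub finite_subset by blast+
  have le_n: "card J \<le> n" "card K \<le> n" "card T \<le> n"
    using sub card_mono[of "{..<n}"] by fastforce+
  \<comment> \<open>The interval \<open>{b..n - b}\<close> has n - 2b steps, which leaves 2b
    residues for \<open>J\<close> and \<open>K\<close> together.\<close>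
  have JK2: "card J + card K \<le> 2 * b" if "J \<noteq> {}" "K \<noteq> {}"
    using card_add_le_of_disjoint_sumset_mod[OF sub(1,2) that _ JK] n by linarith
  have JK1: "card J + card K \<le> n"
    using JK2 le_n n by (cases "J = {}"; cases "K = {}") auto
  have nn: "real n \<ge> 3 * real b" "real n \<le> 4 * real b" using n by linarith+
  have mul: "(real n - 2 * real b) * (real (card J) + real (card K)) \<le> (real n - 2 * real b) * real n"
    using JK1 nn by (intro mult_left_mono) linarith+
  show ?thesis
  proof (cases u)
    case True
    then show ?thesis using u mul by (simp add: algebra_simps)
  next
    case False
    consider "T = {}" | "J \<union> K = {}" | "T \<noteq> {}" "J \<union> K \<noteq> {}" by blast
    then show ?thesis
    proof cases
      case 1
      have "(real n - 2 * real b) * real n \<le> 2 * real b * real n"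
        using nn by (intro mult_right_mono) linarith+
      then show ?thesis using 1 False mul by (simp add: algebra_simps)
    next
      case 2
      then have "J = {}" "K = {}" by auto
      moreover have "2 * real b * card T \<le> 2 * real b * n" using le_n by (intro mult_left_mono) auto
      ultimately show ?thesis using False by (simp add: algebra_simps)
    next
      case 3
      \<comment> \<open>Here the interval has n - 3b steps, so 3b residues remain.\<close>
      have T: "card (J \<union> K) + card T \<le> 3 * b"
        using card_add_le_of_disjoint_sumset_mod[OF Un_least[OF sub(1,2)] sub(3) 3(2,1) _ JT] n
        by linarith
      define j k t where "j = real (card J)" and "k = real (card K)" and "t = real (card T)"
      have "card J \<le> card (J \<union> K)" "card K \<le> card (J \<union> K)" using fin by (auto intro: card_mono)
      then have jt: "j + t \<le> 3 * real b" "k + t \<le> 3 * real b"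
        using T unfolding j_def k_def t_def by linarith+
      have pos: "0 \<le> j" "0 \<le> k" by (auto simp: j_def k_def)
      have "2 * real b * t + (real n - 2 * real b) * (j + k) \<le> 2 * real n * real b"
      proof (cases "J = {} \<or> K = {}")
        case True
        \<comment> \<open>With one of the two sets empty, the weight is at most 6bb + (n - 4b)(j +
          k) \<le> 6bb \<le> 2nb; this is where 3b \<le> n enters.\<close>
        then have "j = 0 \<or> k = 0" by (auto simp: j_def k_def)
        then have "t \<le> 3 * real b - (j + k)" using jt by auto
        then have "2 * real b * t \<le> 2 * real b * (3 * real b - (j + k))" by (intro mult_left_mono) auto
        moreover have "(real n - 4 * real b) * (j + k) \<le> 0" using nn pos by (intro mult_nonpos_nonneg) auto
        moreover have "3 * real b * real b \<le> real n * real b" using nn by (intro mult_right_mono) auto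
        ultimately show ?thesis by (simp add: algebra_simps)
      next
        case False
        then have "card J + card K \<le> 2 * b" using JK2 by auto
        then have s: "j + k \<le> 2 * real b" unfolding j_def k_def by linarith
        \<comment> \<open>Adding both bounds in \<open>jt\<close> makes the weight at most 6bb + (n
          - 3b)(j + k), and j + k \<le> 2b turns this into 2nb.\<close>
        have "2 * t \<le> 6 * real b - (j + k)" using jt by linarith
        then have "real b * (2 * t) \<le> real b * (6 * real b - (j + k))" by (intro mult_left_mono) auto
        moreover have "(real n - 3 * real b) * (j + k) \<le> (real n - 3 * real b) * (2 * real b)"
          using s nn by (intro mult_left_mono) auto
        ultimately show ?thesis by (simp add: algebra_simps)
      qed
      then show ?thesis using False by (simp add: j_def k_def t_def)
    qed
  qed
qed


section \<open>The graph and the gadget inequality\<close>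

lemma sumset_mod_disjointI:
  assumes "\<And>s l t. s \<in> J \<Longrightarrow> l \<in> L \<Longrightarrow> t \<in> T \<Longrightarrow> t = (s + l) mod n \<Longrightarrow> False"
  shows "sumset_mod n J L \<inter> T = {}"
  using assms by (auto simp: sumset_mod_def)

text \<open>Each edge is listed in one orientation. The ranges of \<open>l\<close> are those for
  which, on the cycle of n residues, an arc of length b at s misses the arc at s + l, of length 2b
  for \<open>X\<close> and \<open>V\<close> and of length b for \<open>P\<close>.\<close>

inductive arc :: "nat \<Rightarrow> nat \<Rightarrow> nat \<Rightarrow> vtx \<Rightarrow> vtx \<Rightarrow> bool" for n b N where
  WX: "i < N \<Longrightarrow> t < n \<Longrightarrow> arc n b N (W i) (X i t)"
| UX: "i < N \<Longrightarrow> t < n \<Longrightarrow> arc n b N (U i) (X i t)"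
| UV: "i < N \<Longrightarrow> t < n \<Longrightarrow> arc n b N (U i) (V t)"
| PX: "i < N \<Longrightarrow> s < n \<Longrightarrow> l \<in> {b..n - 2 * b} \<Longrightarrow> arc n b N (P i c s) (X i ((s + l) mod n))"
| PV: "i < N \<Longrightarrow> s < n \<Longrightarrow> l \<in> {b..n - 2 * b} \<Longrightarrow> arc n b N (P i c s) (V ((s + l) mod n))"
| PP: "i < N \<Longrightarrow> s < n \<Longrightarrow> l \<in> {b..n - b} \<Longrightarrow> arc n b N (P i True s) (P i False ((s + l) mod n))"

definition edge :: "nat \<Rightarrow> nat \<Rightarrow> nat \<Rightarrow> vtx \<Rightarrow> vtx \<Rightarrow> bool" where
  "edge n b N u v \<longleftrightarrow> arc n b N u v \<or> arc n b N v u"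

definition verts :: "nat \<Rightarrow> nat \<Rightarrow> vtx set" where
  "verts n N = W ` {..<N} \<union> (\<lambda>(i, t). X i t) ` ({..<N} \<times> {..<n}) \<union> U ` {..<N}
     \<union> (\<lambda>(i, c, s). P i c s) ` ({..<N} \<times> UNIV \<times> {..<n}) \<union> V ` {..<n}"

lemma verts_iff [simp]:
  "W i \<in> verts n N \<longleftrightarrow> i < N"
  "X i t \<in> verts n N \<longleftrightarrow> i < N \<and> t < n"
  "U i \<in> verts n N \<longleftrightarrow> i < N"
  "P i c s \<in> verts n N \<longleftrightarrow> i < N \<and> s < n"
  "V t \<in> verts n N \<longleftrightarrow> t < n"
  by (auto simp: verts_def image_iff)

lemma simple_graph_verts_edge: "simple_graph (verts n N) (edge n b N)"
proof -
  have "u \<in> verts n N \<and> v \<in> verts n N \<and> u \<noteq> v" if "arc n b N u v" for u v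
    using that by cases auto
  moreover have "finite (verts n N)" by (simp add: verts_def)
  ultimately show ?thesis unfolding simple_graph_def edge_def by blast
qed

lemma unit_subset_lmeasurable:
  assumes "unit_subset m S"
  shows "S \<in> lmeasurable" "measure lebesgue S = 1"
  using assms by (auto simp: unit_subset_def fmeasurable_def measure_def)

lemma sum_indicator_eq_card:
  fixes n :: nat
  shows
  "(\<Sum>t<n. indicator (A t) x :: real) = card {t. t < n \<and> x \<in> A t}"
proof -
  have "(\<Sum>t<n. indicator (A t) x :: real) = (\<Sum>t\<in>{t. t < n \<and> x \<in> A t}. 1)"
    by (rule sum.mono_neutral_cong_right) (auto simp: indicator_def)
  then show ?thesis by simp
qed

text \<open>The pointwise bound on independent sets, integrated over [0,m). Dividing by 2nb shows
  that the average over t of the overlap of \<open>W i\<close> with \<open>V t\<close> is at most m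
  - k.\<close>

lemma gadget_inequality:
  assumes n: "3 * b \<le> n" "n \<le> 4 * b" and i: "i < N"
    and f: "frac_coloring (verts n N) (edge n b N) m f" and m: "0 \<le> m"
  shows "real n * (real n + 2 * real b)
           + 2 * real b * (\<Sum>t<n. measure lebesgue (f (W i) \<inter> f (V t))) \<le> 2 * real n * real b * m"
proof -
  have unit: "unit_subset m (f v)" if "v \<in> verts n N" for v
    using f that by (auto simp: frac_coloring_def)
  note lm = unit_subset_lmeasurable[OF unit]
  have adj: "x \<notin> f u \<or> x \<notin> f v" if "arc n b N u v" for u v x
  proof -
    have "edge n b N u v" using that by (simp add: edge_def)
    moreover from this have "u \<in> verts n N" "v \<in> verts n N"
      using simple_graph_verts_edge[of n N b] unfolding simple_graph_def by blast+
    ultimately show ?thesis using f unfolding frac_coloring_def by blast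
  qed
  \<comment> \<open>The weight of the vertices that use colour x; \<open>W i\<close> itself has
    weight zero, but a colour shared by \<open>W i\<close> and \<open>V t\<close> counts with the
    weight of \<open>X i t\<close>.\<close>
  define \<Phi> :: "real \<Rightarrow> real" where "\<Phi> = (\<lambda>x.
      (2 * real b * (\<Sum>t<n. indicator (f (X i t)) x)
       + (real n - 2 * real b) * ((\<Sum>s<n. indicator (f (P i True s)) x) + (\<Sum>s<n. indicator (f (P i False s)) x)))
       + ((4 * real b - real n) * real n) * indicator (f (U i)) x
       + 2 * real b * (\<Sum>t<n. indicator (f (W i) \<inter> f (V t)) x))"
  have int: "has_bochner_integral lebesgue (indicator A :: real \<Rightarrow> real) (measure lebesgue A)"
    if "A \<in> lmeasurable" for A
    using that by (intro has_bochner_integral_real_indicator) (auto simp: fmeasurable_def)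
  have "has_bochner_integral lebesgue \<Phi>
      ((2 * real b * (\<Sum>t<n. measure lebesgue (f (X i t)))
       + (real n - 2 * real b) * ((\<Sum>s<n. measure lebesgue (f (P i True s))) + (\<Sum>s<n. measure lebesgue (f (P i False s)))))
       + ((4 * real b - real n) * real n) * measure lebesgue (f (U i))
       + 2 * real b * (\<Sum>t<n. measure lebesgue (f (W i) \<inter> f (V t))))"
    unfolding \<Phi>_def using i
    by (intro has_bochner_integral_add has_bochner_integral_mult_right has_bochner_integral_sum int fmeasurable.Int lm) auto
  moreover have "(\<Sum>t<n. measure lebesgue (f (X i t))) = n" "(\<Sum>s<n. measure lebesgue (f (P i c s))) = n"
      "measure lebesgue (f (U i)) = 1" for c
    using i by (simp_all add: lm)
  \<comment> \<open>All colour sets have measure one, and the weights sum to 2bn + 2n(n - 2b) + (4b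
    - n)n = n(n + 2b).\<close>
  ultimately have \<Phi>: "has_bochner_integral lebesgue \<Phi> (real n * (real n + 2 * real b)
       + 2 * real b * (\<Sum>t<n. measure lebesgue (f (W i) \<inter> f (V t))))"
    by (simp add: algebra_simps)
  have B: "has_bochner_integral lebesgue (\<lambda>x. 2 * real n * real b * indicator {0..<m} x) (2 * real n * real b * m)"
    using has_bochner_integral_mult_right[OF int[of "{0..<m}"], of "2 * real n * real b"] m
    by (simp add: fmeasurable_def)
  have "\<Phi> x \<le> 2 * real n * real b * indicator {0..<m} x" for x
  proof (cases "x \<in> {0..<m}")
    case False
    then have "x \<notin> f v" if "v \<in> verts n N" for v using unit[OF that] by (auto simp: unit_subset_def)
    then have "\<Phi> x = 0" using i by (simp add: \<Phi>_def)
    then show ?thesis using False by simp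
  next
    case True
    define J K where "J = {s. s < n \<and> x \<in> f (P i True s)}" and "K = {s. s < n \<and> x \<in> f (P i False s)}"
    \<comment> \<open>A colour of \<open>W i\<close> is absent from every \<open>X i t\<close>, so
      \<open>V t\<close> can stand in for \<open>X i t\<close>; the constraints from
      \<open>P\<close> and \<open>U\<close> are the same for both.\<close>
    define T where "T = {t. t < n \<and> x \<in> (if x \<in> f (W i) then f (V t) else f (X i t))}"
    have JK: "sumset_mod n J {b..n - b} \<inter> K = {}"
      by (rule sumset_mod_disjointI) (use adj[OF PP[OF i]] in \<open>auto simp: J_def K_def\<close>)
    have JT: "sumset_mod n (J \<union> K) {b..n - 2 * b} \<inter> T = {}"
      by (rule sumset_mod_disjointI)
        (use adj[OF PX[OF i]] adj[OF PV[OF i]] in \<open>auto simp: J_def K_def T_def split: if_splits\<close>)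
    have u: "T = {}" if "x \<in> f (U i)"
      using adj[OF UX[OF i]] adj[OF UV[OF i]] that by (auto simp: T_def)
    have "{t. t < n \<and> x \<in> f (X i t)} = {}" if "x \<in> f (W i)"
      using adj[OF WX[OF i]] that by auto
    then have "card {t. t < n \<and> x \<in> f (X i t)} + card {t. t < n \<and> x \<in> f (W i) \<inter> f (V t)} = card T"
      by (cases "x \<in> f (W i)") (simp_all add: T_def)
    then have T: "real (card T) = real (card {t. t < n \<and> x \<in> f (X i t)})
        + real (card {t. t < n \<and> x \<in> f (W i) \<inter> f (V t)})" by (metis of_nat_add)
    have "\<Phi> x = 2 * real b * card T + (real n - 2 * real b) * (real (card J) + real (card K))
           + (if x \<in> f (U i) then (4 * real b - real n) * real n else 0)"
      unfolding \<Phi>_def sum_indicator_eq_card T J_def K_def by (simp add: algebra_simps indicator_def)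
    also have "\<dots> \<le> 2 * real n * real b"
      by (rule independent_weight_le[OF n _ _ _ JK JT u]) (auto simp: J_def K_def T_def)
    finally show ?thesis using True by simp
  qed
  then have "integral\<^sup>L lebesgue \<Phi> \<le> integral\<^sup>L lebesgue (\<lambda>x. 2 * real n * real b * indicator {0..<m} x)"
    by (intro integral_mono integrable.intros[OF \<Phi>] integrable.intros[OF B])
  then show ?thesis
    unfolding has_bochner_integral_integral_eq[OF \<Phi>] has_bochner_integral_integral_eq[OF B] .
qed

section \<open>Measures of unions of cells\<close>

text \<open>The union of the intervals $[j/q, (j+1)/q)$ with \<open>j \<in> A\<close>.\<close>

definition cells :: "real \<Rightarrow> nat set \<Rightarrow> real set" where
  "cells q A = {x. 0 \<le> x \<and> nat \<lfloor>q * x\<rfloor> \<in> A}"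

lemma cells_singleton:
  assumes "0 < q"
  shows "cells q {j} = {real j / q..<real (Suc j) / q}"
proof -
  have "0 \<le> x \<and> nat \<lfloor>q * x\<rfloor> = j \<longleftrightarrow> real j / q \<le> x \<and> x < real (Suc j) / q" for x
  proof -
    have "real j / q \<le> x \<longleftrightarrow> real j \<le> q * x" "x < real (Suc j) / q \<longleftrightarrow> q * x < real j + 1"
      using pos_divide_le_eq[OF assms] pos_less_divide_eq[OF assms]
      by (metis mult.commute, metis mult.commute of_nat_Suc add.commute)
    moreover have "0 \<le> x" if "real j \<le> q * x"
      using zero_le_mult_iff[of q x] order_trans[OF of_nat_0_le_iff that] assms by linarith
    moreover have "nat \<lfloor>q * x\<rfloor> = j \<longleftrightarrow> real j \<le> q * x \<and> q * x < real j + 1" if "0 \<le> x"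
    proof -
      have "0 \<le> \<lfloor>q * x\<rfloor>" using assms that by simp
      then have "nat \<lfloor>q * x\<rfloor> = j \<longleftrightarrow> \<lfloor>q * x\<rfloor> = int j" by auto
      then show ?thesis by (simp add: floor_eq_iff)
    qed
    ultimately show ?thesis by blast
  qed
  then show ?thesis unfolding cells_def
    by (intro set_eqI) (simp only: mem_Collect_eq singleton_iff atLeastLessThan_iff)
qed

lemma cells_lmeasurable:
  assumes "finite A" "0 < q"
  shows "cells q A \<in> lmeasurable" and "measure lebesgue (cells q A) = card A / q"
proof -
  have "cells q A \<in> lmeasurable \<and> measure lebesgue (cells q A) = card A / q"
    using assms(1)
  proof induction
    case empty
    then show ?case by (simp add: cells_def)
  next
    case (insert j A)
    have eq: "cells q (insert j A) = cells q {j} \<union> cells q A" by (auto simp: cells_def)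
    have disj: "cells q {j} \<inter> cells q A = {}" using insert by (auto simp: cells_def)
    have "real j / q \<le> real (Suc j) / q" using assms(2) by (intro divide_right_mono) auto
    moreover have "real (Suc j) / q - real j / q = 1 / q" by (simp add: diff_divide_distrib[symmetric])
    ultimately have j: "cells q {j} \<in> lmeasurable" "measure lebesgue (cells q {j}) = 1 / q"
      unfolding cells_singleton[OF assms(2)] by (simp_all add: fmeasurable_def)
    then have "measure lebesgue (cells q (insert j A)) = 1 / q + card A / q"
      unfolding eq using insert disj by (subst measure_Un3) auto
    then show ?case
      using insert j unfolding eq by (simp add: fmeasurable.Un add_divide_distrib)
  qed
  then show "cells q A \<in> lmeasurable" and "measure lebesgue (cells q A) = card A / q" by auto
qed

lemma cells_subset:
  assumes "0 < q" "A \<subseteq> {..<n}"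
  shows "cells q A \<subseteq> {0..<real n / q}"
proof
  fix x assume x: "x \<in> cells q A"
  then have "nat \<lfloor>q * x\<rfloor> < n" "0 \<le> x" using assms by (auto simp: cells_def)
  then have "q * x < real n" by linarith
  then show "x \<in> {0..<real n / q}" using \<open>0 \<le> x\<close> assms by (simp add: field_simps)
qed

lemma unit_subset_cells:
  assumes "0 < q" "A \<subseteq> {..<n}" "card A = q"
  shows "unit_subset (real n / real q) (cells (real q) A)"
proof -
  have "finite A" using assms(2) finite_subset by blast
  then have "cells (real q) A \<in> lmeasurable" "measure lebesgue (cells (real q) A) = 1"
    using cells_lmeasurable[of A "real q"] assms by auto
  then show ?thesis
    using cells_subset[of "real q" A n] assms by (auto simp: unit_subset_def emeasure_eq_measure2)
qed

lemma sum_cells_Int: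
  assumes "0 < q" "finite J" "A \<in> lmeasurable"
  shows "(\<Sum>j\<in>J. measure lebesgue (cells q {j} \<inter> A)) = measure lebesgue (cells q J \<inter> A)"
proof -
  have "cells q J \<inter> A = (\<Union>j\<in>J. cells q {j} \<inter> A)" by (auto simp: cells_def)
  moreover have "measure lebesgue (\<Union>j\<in>J. cells q {j} \<inter> A) = (\<Sum>j\<in>J. measure lebesgue (cells q {j} \<inter> A))"
  proof (rule measure_UNION')
    show "finite J" by fact
    show "cells q {j} \<inter> A \<in> lmeasurable" for j
      using assms by (intro fmeasurable.Int cells_lmeasurable) auto
    show "pairwise (\<lambda>i j. disjnt (cells q {i} \<inter> A) (cells q {j} \<inter> A)) J"
      by (auto simp: pairwise_def disjnt_def cells_def)
  qed
  ultimately show ?thesis by simp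
qed

section \<open>Equidistributed arcs of the circle\<close>

text \<open>The arc of length one starting at $im/N$ on the circle $[0,m)$, cut open at $0$.\<close>

definition circle_arc :: "real \<Rightarrow> nat \<Rightarrow> nat \<Rightarrow> real set" where
  "circle_arc m N i =
     {0..<m} \<inter> ({real i * m / N..<real i * m / N + 1} \<union> {real i * m / N - m..<real i * m / N + 1 - m})"

lemma unit_subset_circle_arc:
  assumes "1 < m" "i < N"
  shows "unit_subset m (circle_arc m N i)"
proof -
  define p where "p = real i * m / N"
  have p: "0 \<le> p" "p < m" using assms by (auto simp: p_def field_simps)
  \<comment> \<open>The minimum and maximum treat wrapping and non-wrapping arcs at once. The two
    pieces are disjoint because m > 1 gives p + 1 - m < p.\<close>
  have eq: "circle_arc m N i = {p..<min (p + 1) m} \<union> {0..<max 0 (p + 1 - m)}"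
    using p assms(1) unfolding circle_arc_def p_def[symmetric] by auto
  have "emeasure lebesgue (circle_arc m N i) = ennreal (min (p + 1) m - p) + ennreal (max 0 (p + 1 - m))"
    unfolding eq using p assms(1) by (subst plus_emeasure[symmetric]) (auto simp: min_def max_def)
  also have "\<dots> = ennreal (min (p + 1) m - p + max 0 (p + 1 - m))"
    using p by (intro ennreal_plus[symmetric]) auto
  also have "min (p + 1) m - p + max 0 (p + 1 - m) = 1" by (simp add: min_def max_def)
  finally show ?thesis by (auto simp: unit_subset_def circle_arc_def)
qed

lemma sum_shift_mod:
  fixes g :: "nat \<Rightarrow> 'b :: comm_monoid_add"
  assumes "0 < N"
  shows "(\<Sum>i<N. g ((l + i) mod N)) = (\<Sum>j<N. g j)"
proof -
  have "(\<lambda>i. (l + i) mod N) ` {..<N} = {..<N}"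
    by (rule endo_inj_surj) (use assms inj_on_add_mod in auto)
  then have "bij_betw (\<lambda>i. (l + i) mod N) {..<N} {..<N}"
    using inj_on_add_mod by (simp add: bij_betw_def)
  then show ?thesis by (rule sum.reindex_bij_betw)
qed

text \<open>Double counting over a partition of [0,m) into N equal cells: each arc contains the
  first \<lfloor>N/m\<rfloor> cells from its starting point, so each cell is counted at least that
  often. Rounding down costs at most 1.\<close>

lemma sum_measure_circle_arc_ge:
  assumes "1 < m" "0 < N" and A: "unit_subset m A"
  shows "(\<Sum>i<N. measure lebesgue (circle_arc m N i \<inter> A)) \<ge> N / m - 1"
proof -
  \<comment> \<open>Cells have length 1/q = m/N, and \<open>r\<close> is the number of whole cells
    that fit into a unit arc.\<close>
  define q r where "q = N / m" and "r = nat \<lfloor>q\<rfloor>"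
  have q: "0 < q" "real N / q = m" using assms by (auto simp: q_def)
  have r: "real r \<le> q" "q - 1 \<le> real r" using q unfolding r_def by linarith+
  have "q \<le> real N" using assms by (simp add: q_def field_simps)
  then have rN: "r \<le> N" using r by linarith
  note lm = unit_subset_lmeasurable[OF A]
  have arc: "measure lebesgue (circle_arc m N i \<inter> A) \<ge> (\<Sum>l<r. measure lebesgue (cells q {(i + l) mod N} \<inter> A))"
    if i: "i < N" for i
  proof -
    have inj: "inj_on (\<lambda>l. (i + l) mod N) {..<r}"
      by (rule inj_on_subset[OF inj_on_add_mod]) (use rN in auto)
    have sub: "cells q {(i + l) mod N} \<subseteq> circle_arc m N i" if l: "l < r" for l
    proof -
      have "real (Suc l) \<le> q" using l r by linarith
      then have l1: "(1 + real l) / q \<le> 1" using q by (simp add: field_simps)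
      have p: "real i * m / N = i / q" using assms by (simp add: q_def)
      show ?thesis
      proof
        fix x assume "x \<in> cells q {(i + l) mod N}"
        then have x: "real ((i + l) mod N) / q \<le> x" "x < (real ((i + l) mod N) + 1) / q"
          using cells_singleton[OF q(1)] by (auto simp: add.commute)
        have "(i + l) mod N + 1 \<le> N" using assms(2) by (simp add: Suc_leI)
        then have "real ((i + l) mod N) + 1 \<le> N" by linarith
        then have "(real ((i + l) mod N) + 1) / q \<le> m" using q by (metis divide_right_mono less_imp_le)
        then have x0m: "x \<in> {0..<m}" using x order_trans[OF _ x(1), of 0] q(1) by simp
        show "x \<in> circle_arc m N i"
        proof (cases "i + l < N")
          case True
          then have "real i / q + real l / q \<le> x" "x < real i / q + (1 + real l) / q"
            using x by (simp_all add: add_divide_distrib)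
          moreover have "0 \<le> real l / q" using q by simp
          ultimately have "real i / q \<le> x" "x < real i / q + 1" using l1 by linarith+
          then show ?thesis using x0m unfolding circle_arc_def p by simp
        next
          case False
          \<comment> \<open>Past index N the cell wraps round and lies in the second interval of
            \<open>circle_arc\<close>, shifted by m = N/q.\<close>
          then have "(i + l) mod N = i + l - N" using i rN l by (simp add: mod_if)
          then have "real ((i + l) mod N) = real i + real l - real N" using False by simp
          then have "real i / q + real l / q - m \<le> x" "x < real i / q + (1 + real l) / q - m"
            using x q(2) by (simp_all add: add_divide_distrib diff_divide_distrib)
          moreover have "0 \<le> real l / q" using q by simp
          ultimately have "real i / q - m \<le> x" "x < real i / q + 1 - m" using l1 by linarith+
          then show ?thesis using x0m unfolding circle_arc_def p by simp
        qed
      qed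
    qed
    have "(\<Sum>l<r. measure lebesgue (cells q {(i + l) mod N} \<inter> A))
        = (\<Sum>j\<in>(\<lambda>l. (i + l) mod N) ` {..<r}. measure lebesgue (cells q {j} \<inter> A))"
      by (simp add: sum.reindex[OF inj])
    also have "\<dots> = measure lebesgue (cells q ((\<lambda>l. (i + l) mod N) ` {..<r}) \<inter> A)"
      using q lm by (intro sum_cells_Int) auto
    also have "\<dots> \<le> measure lebesgue (circle_arc m N i \<inter> A)"
    proof (rule measure_mono_fmeasurable)
      show "cells q ((\<lambda>l. (i + l) mod N) ` {..<r}) \<inter> A \<subseteq> circle_arc m N i \<inter> A"
        using sub by (fastforce simp: cells_def)
      show "cells q ((\<lambda>l. (i + l) mod N) ` {..<r}) \<inter> A \<in> sets lebesgue"
        using cells_lmeasurable(1)[of "(\<lambda>l. (i + l) mod N) ` {..<r}" q] q lm by auto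
      show "circle_arc m N i \<inter> A \<in> lmeasurable"
        using unit_subset_lmeasurable(1)[OF unit_subset_circle_arc[OF assms(1) i]] lm by auto
    qed
    finally show ?thesis .
  qed
  have "A \<subseteq> cells q {..<N}"
  proof
    fix x assume "x \<in> A"
    then have "0 \<le> x" "x < m" using A by (auto simp: unit_subset_def)
    then have "0 \<le> q * x" "q * x < N" using q by (auto simp: field_simps)
    then have "nat \<lfloor>q * x\<rfloor> < N" by linarith
    then show "x \<in> cells q {..<N}" using \<open>0 \<le> x\<close> by (simp add: cells_def)
  qed
  then have all: "(\<Sum>j<N. measure lebesgue (cells q {j} \<inter> A)) = 1"
    using sum_cells_Int[OF q(1) _ lm(1), of "{..<N}"] lm by (simp add: Int_absorb1)
  \<comment> \<open>For fixed l the index (l + i) mod N runs through every cell once, so the inner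
    sum is the whole measure of \<open>A\<close>.\<close>
  have "real r = (\<Sum>l<r. \<Sum>i<N. measure lebesgue (cells q {(l + i) mod N} \<inter> A))"
    using all sum_shift_mod[OF assms(2), of "\<lambda>j. measure lebesgue (cells q {j} \<inter> A)"] by simp
  also have "\<dots> = (\<Sum>i<N. \<Sum>l<r. measure lebesgue (cells q {(i + l) mod N} \<inter> A))"
    by (subst sum.swap) (simp add: add.commute)
  also have "\<dots> \<le> (\<Sum>i<N. measure lebesgue (circle_arc m N i \<inter> A))"
    using arc by (intro sum_mono) auto
  finally show ?thesis using r by (simp add: q_def)
qed

section \<open>An optimal colouring and the fractional chromatic number\<close>

definition arc_mod :: "nat \<Rightarrow> nat \<Rightarrow> nat \<Rightarrow> nat set" where
  "arc_mod n s d = (\<lambda>j. (s + j) mod n) ` {..<d}"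

lemma arc_mod_subset: "0 < n \<Longrightarrow> arc_mod n s d \<subseteq> {..<n}"
  by (auto simp: arc_mod_def)

lemma card_arc_mod: "d \<le> n \<Longrightarrow> card (arc_mod n s d) = d"
  unfolding arc_mod_def
  using card_image[OF inj_on_subset[OF inj_on_add_mod[of s n], of "{..<d}"]] by simp

text \<open>Measured from s, the arcs occupy the offsets below d and those from l to l + e - 1, all
  within one turn of the cycle.\<close>

lemma arc_mod_disjoint:
  assumes "d \<le> l" "l + e \<le> n"
  shows "arc_mod n s d \<inter> arc_mod n ((s + l) mod n) e = {}"
proof -
  have False if "i < d" "j < e" "(s + i) mod n = ((s + l) mod n + j) mod n" for i j
  proof -
    have "(s + i) mod n = (s + (l + j)) mod n" using that(3) by (simp add: mod_add_left_eq add.assoc)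
    then have "i = l + j"
      using inj_onD[OF inj_on_add_mod[of s n], of i "l + j"] that assms by simp
    then show False using that assms by simp
  qed
  then show ?thesis unfolding arc_mod_def by blast
qed

text \<open>
  Two vertices joined by an edge occupy disjoint arcs of the cells below $n$ because the offset $l$ in
  the definition of \<open>arc\<close> keeps them apart, or they are separated by the $2b$ extra cells.
\<close>

fun cell_labels :: "nat \<Rightarrow> nat \<Rightarrow> vtx \<Rightarrow> nat set" where
  "cell_labels n b (W i) = {n..<n + 2 * b}"
| "cell_labels n b (U i) = {n..<n + 2 * b}"
| "cell_labels n b (X i t) = arc_mod n t (2 * b)"
| "cell_labels n b (V t) = arc_mod n t (2 * b)"
| "cell_labels n b (P i c s) = arc_mod n s b \<union> (if c then {n..<n + b} else {n + b..<n + 2 * b})"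

text \<open>Every vertex receives 2b of the n + 2b cells of length 1/(2b), which gives the upper
  bound k on the fractional chromatic number.\<close>

lemma frac_coloring_cells:
  assumes n: "3 * b \<le> n" and b: "0 < b"
  shows "frac_coloring (verts n N) (edge n b N) ((n + 2 * b) / (2 * b))
           (\<lambda>v. cells (2 * b) (cell_labels n b v))"
proof -
  have n0: "0 < n" using n b by simp
  have sub: "arc_mod n s d \<subseteq> {..<n}" for s d using arc_mod_subset[OF n0] .
  have fin: "finite (arc_mod n s d)" for s d by (simp add: arc_mod_def)
  have lt: "x < n" if "x \<in> arc_mod n s d" for x s d using subsetD[OF sub that] by simp
  have disj: "arc_mod n s d \<inter> {p..<q} = {}" if "n \<le> p" for s d p q using sub[of s d] that by force
  have "cell_labels n b v \<subseteq> {..<n + 2 * b}" for v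
  proof -
    have "{..<n} \<subseteq> {..<n + 2 * b}" by auto
    then show ?thesis using sub by (cases v) (auto dest: subsetD[OF sub])
  qed
  moreover have "card (cell_labels n b v) = 2 * b" for v
    using n by (cases v) (simp_all add: card_arc_mod card_Un_disjoint[OF fin _ disj])
  ultimately have "unit_subset (real (n + 2 * b) / real (2 * b)) (cells (real (2 * b)) (cell_labels n b v))" for v
    using b by (intro unit_subset_cells) auto
  moreover have "cells q (cell_labels n b u) \<inter> cells q (cell_labels n b v) = {}" if "edge n b N u v" for u v q
  proof -
    have "cell_labels n b u \<inter> cell_labels n b v = {}" if "arc n b N u v" for u v
      using that
    proof cases
      case (PX i s l c)
      then have "b \<le> l" "l + 2 * b \<le> n" using n by auto
      then show ?thesis using PX arc_mod_disjoint[of b l "2 * b" n s] by (auto dest: lt split: if_splits)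
    next
      case (PV i s l c)
      then have "b \<le> l" "l + 2 * b \<le> n" using n by auto
      then show ?thesis using PV arc_mod_disjoint[of b l "2 * b" n s] by (auto dest: lt split: if_splits)
    next
      case (PP i s l)
      then have "b \<le> l" "l + b \<le> n" using n by auto
      then show ?thesis using PP arc_mod_disjoint[of b l b n s] by (auto dest: lt)
    qed (auto dest: lt)
    then have "cell_labels n b u \<inter> cell_labels n b v = {}" using \<open>edge n b N u v\<close>
      unfolding edge_def by blast
    then show ?thesis by (auto simp: cells_def)
  qed
  ultimately show ?thesis unfolding frac_coloring_def by simp
qed

lemma frac_chromatic_number_verts:
  assumes n: "3 * b \<le> n" "n \<le> 4 * b" and b: "0 < b" and N: "0 < N"
  shows "frac_chromatic_number (verts n N) (edge n b N) = (real n + 2 * real b) / (2 * real b)"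
proof -
  let ?k = "(real n + 2 * real b) / (2 * real b)"
  let ?S = "{m. m > 0 \<and> (\<exists>f. frac_coloring (verts n N) (edge n b N) m f)}"
  have n0: "0 < n" using n b by simp
  have "?k \<in> ?S" using frac_coloring_cells[OF n(1) b, of N] b n0 by (auto simp: add_pos_pos)
  moreover have "?k \<le> m" if "m \<in> ?S" for m
  proof -
    obtain f where f: "frac_coloring (verts n N) (edge n b N) m f" and m: "0 \<le> m"
      using \<open>m \<in> ?S\<close> by (auto dest: less_imp_le)
    \<comment> \<open>Dropping the overlap term from the inequality of a single gadget leaves the
      lower bound k.\<close>
    have "0 \<le> 2 * real b * (\<Sum>t<n. measure lebesgue (f (W 0) \<inter> f (V t)))"
      by (intro mult_nonneg_nonneg sum_nonneg measure_nonneg) auto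
    then have "real n * (real n + 2 * real b) \<le> 2 * real n * real b * m"
      using gadget_inequality[OF n N f m] by linarith
    also have "\<dots> = real n * (2 * real b * m)" by simp
    finally have "real n * (real n + 2 * real b) \<le> real n * (2 * real b * m)" .
    then have "real n + 2 * real b \<le> 2 * real b * m" using n0 by simp
    then show ?thesis using b by (simp add: pos_divide_le_eq mult.commute)
  qed
  ultimately show ?thesis unfolding frac_chromatic_number_def by (intro cInf_eq_minimum)
qed

section \<open>Distances between the precoloured vertices, and non-extendability\<close>

fun dist_from_W :: "nat \<Rightarrow> vtx \<Rightarrow> nat" where
  "dist_from_W i (W j) = (if j = i then 0 else 6)"
| "dist_from_W i (X j t) = (if j = i then 1 else 5)"
| "dist_from_W i (U j) = (if j = i then 2 else 4)"
| "dist_from_W i (P j c s) = (if j = i then 2 else 4)"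
| "dist_from_W i (V t) = 3"

text \<open>The function \<open>dist_from_W i\<close> changes by at most one along an edge, so it
  bounds walk lengths from below. Different gadgets meet only in the vertices \<open>V t\<close>, at
  value 3, whence 3 + 3 for another \<open>W j\<close>.\<close>

lemma pairwise_dist_ge_W: "pairwise_dist_ge (verts n N) (edge n b N) (W ` {..<N}) 6"
proof -
  have step: "dist_from_W i v \<le> Suc (dist_from_W i u) \<and> dist_from_W i u \<le> Suc (dist_from_W i v)"
    if "arc n b N u v" for i u v
    using that by cases auto
  have "dist_from_W i v \<le> dist_from_W i u + d" if "walk (verts n N) (edge n b N) d u v" for i u v d
    using that
  proof induction
    case (walk_step d u w v)
    have "dist_from_W i v \<le> Suc (dist_from_W i w)"
      using walk_step.hyps(2) step unfolding edge_def by blast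
    then show ?case using walk_step.IH by simp
  qed simp
  from this[where u = "W i" and i = i for i] show ?thesis
    unfolding pairwise_dist_ge_def by fastforce
qed

text \<open>Summing the gadget inequality over i and applying equidistribution at each
  \<open>V t\<close> yields Nk + N/m - 1 \<le> Nm. The 1 in \<open>gap\<close> is the rounding loss
  of \<open>sum_measure_circle_arc_ge\<close>.\<close>

lemma not_precoloring_extends:
  assumes n: "3 * b \<le> n" "n \<le> 4 * b" and b: "0 < b" and N: "0 < N" and m: "1 < m"
    and gap: "real N * (1 / m - (m - (real n + 2 * real b) / (2 * real b))) > 1"
    and p: "\<And>i. i < N \<Longrightarrow> p (W i) = circle_arc m N i"
  shows "\<not> precoloring_extends (verts n N) (edge n b N) (W ` {..<N}) m p"
proof
  assume "precoloring_extends (verts n N) (edge n b N) (W ` {..<N}) m p"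
  then obtain f where f: "frac_coloring (verts n N) (edge n b N) m f" and "\<And>i. i < N \<Longrightarrow> f (W i) = p (W i)"
    unfolding precoloring_extends_def by blast
  then have fW: "f (W i) = circle_arc m N i" if "i < N" for i using p that by simp
  define k where "k = (real n + 2 * real b) / (2 * real b)"
  have k: "real n + 2 * real b = 2 * real b * k" using b by (simp add: k_def)
  have n0: "0 < n" using n b by simp
  define \<mu> where "\<mu> i t = measure lebesgue (circle_arc m N i \<inter> f (V t))" for i t
  have "(2 * real b) * (real n * k + (\<Sum>t<n. \<mu> i t)) \<le> (2 * real b) * (real n * m)" if "i < N" for i
    using gadget_inequality[OF n that f] m fW[OF that] unfolding k \<mu>_def by (simp add: algebra_simps)
  then have "real n * k + (\<Sum>t<n. \<mu> i t) \<le> real n * m" if "i < N" for i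
    using that b by (simp only: mult_le_cancel_left_pos of_nat_0_less_iff zero_less_mult_iff zero_less_numeral simp_thms)
  then have "(\<Sum>i<N. real n * k + (\<Sum>t<n. \<mu> i t)) \<le> (\<Sum>i<N. real n * m)"
    by (intro sum_mono) auto
  moreover have "(\<Sum>i<N. \<Sum>t<n. \<mu> i t) = (\<Sum>t<n. \<Sum>i<N. \<mu> i t)" by (rule sum.swap)
  moreover have "(\<Sum>t<n. \<Sum>i<N. \<mu> i t) \<ge> (\<Sum>t<n. N / m - 1)"
  proof (rule sum_mono)
    fix t assume "t \<in> {..<n}"
    then have "unit_subset m (f (V t))" using f by (simp add: frac_coloring_def)
    then show "N / m - 1 \<le> (\<Sum>i<N. \<mu> i t)" unfolding \<mu>_def by (rule sum_measure_circle_arc_ge[OF m N])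
  qed
  ultimately have "real n * (N * k + (N / m - 1)) \<le> real n * (N * m)"
    by (simp add: sum.distrib algebra_simps)
  then have "N * k + (N / m - 1) \<le> N * m" using n0 by simp
  then show False using gap unfolding k_def[symmetric] by (simp add: algebra_simps)
qed

section \<open>Transport along an injection, since the theorem asks for natural numbers as
  vertices\<close>

context
  fixes V :: "'a set" and E :: "'a \<Rightarrow> 'a \<Rightarrow> bool" and h :: "'a \<Rightarrow> 'b" and g :: "'b \<Rightarrow> 'a"
    and E' :: "'b \<Rightarrow> 'b \<Rightarrow> bool"
  assumes gh: "\<And>x. g (h x) = x"
  defines "E' \<equiv> \<lambda>u v. \<exists>x y. u = h x \<and> v = h y \<and> E x y"
begin

lemma image_edge_iff: "E' (h x) (h y) \<longleftrightarrow> E x y"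
  unfolding E'_def using gh by metis

lemma simple_graph_image: "simple_graph V E \<Longrightarrow> simple_graph (h ` V) E'"
  unfolding simple_graph_def E'_def using gh by (intro conjI) (blast, blast, blast, metis)

lemma frac_coloring_image_iff: "frac_coloring (h ` V) E' m f \<longleftrightarrow> frac_coloring V E m (f \<circ> h)"
  by (simp add: frac_coloring_def image_edge_iff)

lemma frac_chromatic_number_image: "frac_chromatic_number (h ` V) E' = frac_chromatic_number V E"
proof -
  have "(\<exists>f. frac_coloring (h ` V) E' m f) \<longleftrightarrow> (\<exists>f. frac_coloring V E m f)" for m
  proof
    assume "\<exists>f. frac_coloring V E m f"
    then obtain f where "frac_coloring V E m f" by blast
    \<comment> \<open>Colourings are pulled back by \<open>h\<close> and pushed forward by the left
      inverse \<open>g\<close>.\<close>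
    moreover have "(f \<circ> g) \<circ> h = f" by (simp add: fun_eq_iff gh)
    ultimately show "\<exists>f. frac_coloring (h ` V) E' m f" using frac_coloring_image_iff by metis
  qed (use frac_coloring_image_iff in blast)
  then show ?thesis by (simp add: frac_chromatic_number_def)
qed

text \<open>A walk in the image is carried back by \<open>g\<close> edge by edge, so a short walk
  there would give one in the original graph.\<close>

lemma pairwise_dist_ge_image:
  assumes "pairwise_dist_ge V E S d"
  shows "pairwise_dist_ge (h ` V) E' (h ` S) d"
proof -
  have "walk V E n (g u) (g v)" if "walk (h ` V) E' n u v" for n u v
    using that
  proof induction
    case (walk_refl u)
    then show ?case using gh by (auto intro: walk.walk_refl)
  next
    case (walk_step n u w v)
    then show ?case using gh by (auto simp: E'_def intro: walk.walk_step)
  qed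
  then show ?thesis using assms gh unfolding pairwise_dist_ge_def by (metis imageE)
qed

lemma precoloring_extends_image:
  assumes "precoloring_extends (h ` V) E' (h ` S) m (p \<circ> g)"
  shows "precoloring_extends V E S m p"
proof -
  obtain f where "frac_coloring (h ` V) E' m f" "\<forall>w\<in>h ` S. f w = (p \<circ> g) w"
    using assms unfolding precoloring_extends_def by blast
  then have "frac_coloring V E m (f \<circ> h)" "\<forall>w\<in>S. (f \<circ> h) w = p w"
    by (simp_all add: frac_coloring_image_iff gh)
  then show ?thesis unfolding precoloring_extends_def by blast
qed

end

theorem mainTheorem14:
  fixes k \<epsilon> :: real
  assumes "k \<in> \<rat>" and "5/2 \<le> k" and "k < 3"
    and "0 < \<epsilon>" and "\<epsilon> < 1 / (k + \<epsilon>)"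
  shows "\<exists>(V :: nat set) E. simple_graph V E \<and> frac_chromatic_number V E = k \<and>
           (\<exists>W \<subseteq> V. pairwise_dist_ge V E W 6 \<and>
              (\<exists>p. frac_precoloring W (k + \<epsilon>) p \<and> \<not> precoloring_extends V E W (k + \<epsilon>) p))"
proof -
  obtain a b :: nat where b: "b \<noteq> 0" and "\<bar>k\<bar> = real a / real b"
    using Rats_abs_nat_div_natE[OF assms(1)] by metis
  then have k: "k = real a / real b" using assms(2) by simp
  \<comment> \<open>Chosen so that (n + 2b)/(2b) = a/b; then 5/2 \<le> k becomes 3b \<le> n, and k <
    3 yields n \<le> 4b.\<close>
  define n where "n = 2 * a - 2 * b"
  have "5 * real b \<le> 2 * real a" "real a < 3 * real b"
    using assms(2,3) b unfolding k by (simp_all add: field_simps)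
  then have ab: "5 * b \<le> 2 * a" "a < 3 * b" by linarith+
  then have n: "3 * b \<le> n" "n \<le> 4 * b" unfolding n_def by linarith+
  have "real n = 2 * real a - 2 * real b" unfolding n_def using ab by simp
  then have kn: "k = (real n + 2 * real b) / (2 * real b)" unfolding k using b by (simp add: field_simps)
  define m where "m = k + \<epsilon>"
  have m: "1 < m" using assms(2,4) by (simp add: m_def)
  \<comment> \<open>Since m - k = \<epsilon>, this is the hypothesis on \<epsilon>; enough gadgets
    then beat the rounding loss 1.\<close>
  have pos: "0 < 1 / m - (m - k)" using assms(5) by (simp add: m_def)
  obtain N where N: "real N * (1 / m - (m - k)) > 1" using ex_less_of_nat_mult[OF pos] by blast
  then have N0: "0 < N" by (cases N) auto
  \<comment> \<open>The empty set is a filler outside the precoloured vertices.\<close>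
  define p where "p v = (case v of W i \<Rightarrow> circle_arc m N i | _ \<Rightarrow> {})" for v
  let ?V = "to_nat ` verts n N" and ?W = "to_nat ` W ` {..<N}"
  let ?E = "\<lambda>u v. \<exists>x y. u = to_nat x \<and> v = to_nat y \<and> edge n b N x y"
  have gh: "from_nat (to_nat x) = x" for x :: vtx by simp
  have "\<not> precoloring_extends (verts n N) (edge n b N) (W ` {..<N}) m p"
    by (rule not_precoloring_extends) (use n b N0 m N in \<open>auto simp: p_def kn\<close>)
  then have "\<not> precoloring_extends ?V ?E ?W m (p \<circ> from_nat)"
    using precoloring_extends_image[of from_nat to_nat, OF gh] by blast
  moreover have "frac_precoloring ?W m (p \<circ> from_nat)"
    using unit_subset_circle_arc[OF m] by (auto simp: frac_precoloring_def p_def)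
  moreover have "frac_chromatic_number ?V ?E = k"
    using frac_chromatic_number_image[of from_nat to_nat, OF gh] frac_chromatic_number_verts[OF n _ N0] b kn by simp
  moreover have "simple_graph ?V ?E"
    using simple_graph_image[of from_nat to_nat, OF gh simple_graph_verts_edge] .
  moreover have "pairwise_dist_ge ?V ?E ?W 6"
    using pairwise_dist_ge_image[of from_nat to_nat, OF gh pairwise_dist_ge_W] .
  moreover have "?W \<subseteq> ?V" by auto
  ultimately show ?thesis unfolding m_def by blast
qed

end
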